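(* Let $X$ be a Banach space, let $A\colon [0,+\infty)\to B(X)$ be continuous, and let $c>0$ and $q>0$. Suppose that the linear equation $v'=A(t)v$ admits a nonuniform $(\mu,\nu)$-dichotomy in $[0,+\infty)$ for some growth rates $\mu,\nu$, with projections $P(t)$ and constants $D\ge 1$, $a<0\le b$, $\varepsilon>0$. Assume that $$\lim_{t\to+\infty}\mu(t)^{a-b}\nu(t)^{\varepsilon}=0\qquad\text{and}\qquad \int_0^{+\infty}\mu(r)^{aq}\nu(r)^{\varepsilon}\,dr \text{ is convergent,}$$ define $$\beta(t)=\frac{\mu(t)^a}{\nu(t)^{\varepsilon(1+1/q)}\left(\int_t^{+\infty}\mu(r)^{aq}\nu(r)^{\varepsilon}\,dr\right)^{1/q}},\qquad \tilde\beta(t)=\beta(t)\,\nu(t)^{-\varepsilon},$$ and suppose that $t\mapsto\beta(t)$ and $t\mapsto\mu(t)^a\beta(t)^{-1}$ are decreasing. Let $C>D$. Then, choosing $\delta>0$ sufficiently small, there exists $K>0$ such that $$\|\phi-\bar\phi\|'\le K\,\|f-\bar f\|'$$ for every $f,\bar f\in\mathcal P_{c,q}$, where $\phi,\bar\phi\in\mathcal X_{\delta,\beta}$ are the functions given by the stable manifold theorem recalled in the context for the perturbations $f$ and $\bar f$, respectively.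
   Context: $B(X)$ is the space of bounded linear operators on $X$. All solutions of $v'=A(t)v$, $v(s)=v_s$ are assumed global, and $T(t,s)$ ($t,s\ge0$) denotes the associated (invertible) evolution operator. A growth rate is an increasing function $\mu\colon[0,+\infty)\to[1,+\infty)$ with $\mu(0)=1$ and $\lim_{t\to+\infty}\mu(t)=+\infty$. The equation $v'=A(t)v$ admits a nonuniform $(\mu,\nu)$-dichotomy in $[0,+\infty)$ (with constants $D,a,b,\varepsilon$) if there are projections $P(t)$, $t\ge 0$, with $P(t)T(t,s)=T(t,s)P(s)$ for all $t,s\ge 0$, and, for all $t\ge s\ge 0$, $$\|T(t,s)P(s)\|\le D\left(\tfrac{\mu(t)}{\mu(s)}\right)^a\nu(s)^\varepsilon,\qquad \|T(t,s)^{-1}Q(t)\|\le D\left(\tfrac{\mu(t)}{\mu(s)}\right)^{-b}\nu(t)^\varepsilon,$$ where $Q(t)=\mathrm{Id}-P(t)$. Put $E(t)=P(t)X$ and $F(t)=Q(t)X$; $E(t)\times F(t)$ is identified with $E(t)\oplus F(t)=X$. $\mathcal P_{c,q}$ is the class of all $f\colon[0,+\infty)\times X\to X$ with $f(t,0)=0$ and $\|f(t,u)-f(t,v)\|\le c\|u-v\|(\|u\|+\|v\|)^q$ for all $t\ge 0$, $u,v\in X$, with metric $$\|f-\bar f\|'=\sup\left\{\frac{\|f(t,u)-\bar f(t,u)\|}{\|u\|^{q+1}}: t\ge 0,\ u\in X\setminus\{0\}\right\}.$$ It is understood that for $f\in\mathcal P_{c,q}$ and each $(s,v_s)\in[0,+\infty)\times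 X$ the problem $v'=A(t)v+f(t,v)$, $v(s)=v_s$ has a unique (maximal forward) solution, written as $(x(t,s,v_s),y(t,s,v_s))\in E(t)\times F(t)$; put $\Psi_\tau(s,v_s)=(s+\tau,x(s+\tau,s,v_s),y(s+\tau,s,v_s))$, $\tau\ge 0$. For $\delta>0$ and a decreasing $\beta\colon[0,+\infty)\to[0,+\infty)$: $B_{s,\delta,\beta}$ is the open ball of $E(s)$ centered at $0$ with radius $\delta\beta(s)$; $G_{\delta,\beta}=\bigcup_{s\ge 0}\{s\}\times B_{s,\delta,\beta}$; $\mathcal X_{\delta,\beta}$ is the space of functions $\phi\colon G_{\delta,\beta}\to X$ such that for all $(s,\xi),(s,\bar\xi)\in G_{\delta,\beta}$: $\phi(s,\xi)\in F(s)$, $\phi(s,0)=0$, $\|\phi(s,\xi)-\phi(s,\bar\xi)\|\le\|\xi-\bar\xi\|$. Its metric is $$\|\phi-\psi\|'=\sup\left\{\frac{\|\phi(s,\xi)-\psi(s,\xi)\|}{\|\xi\|}:(s,\xi)\in G_{\delta,\beta},\ \xi\ne0\right\}.$$ Put $\mathcal V_{\phi,\delta,\beta}=\{(s,\xi,\phi(s,\xi)):(s,\xi)\in G_{\delta,\beta}\}$ and $\mathcal V_{\phi,\frac{\delta}{C},\tilde\beta}=\{(s,\xi,\phi(s,\xi)):(s,\xi)\in G_{\frac{\delta}{C},\tilde\beta}\}$. Stable manifold theorem of the paper: under the assumptions of the claim, for every $C>D$, choosing $\delta>0$ sufficiently small, for $f\in\mathcal P_{c,q}$ there is a unique $\phi\in\mathcal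 X_{\delta,\beta}$ such that $\Psi_\tau(\mathcal V_{\phi,\frac{\delta}{C},\tilde\beta})\subset\mathcal V_{\phi,\delta,\beta}$ for every $\tau\ge 0$. The paper obtains this $\phi$ as the one satisfying, for all $s\ge0$ and $\xi\in B_{s,\delta,\beta}$, $$\phi(s,\xi)=-\int_s^{+\infty}V(r,s)^{-1}f\big(r,x_\phi(r,\xi)+\phi(r,x_\phi(r,\xi))\big)\,dr,$$ where: $U(t,s)=P(t)T(t,s)P(s)$; $V(t,s)=Q(t)T(t,s)Q(s)$, with $V(r,s)^{-1}=T(r,s)^{-1}Q(r)$; $\phi$ is extended to all $\xi\in E(s)$ by $\phi(s,\xi)=\phi(s,\delta\beta(s)\xi/\|\xi\|)$ for $\xi\notin B_{s,\delta,\beta}$ (using the unique Lipschitz extension of $\phi(s,\cdot)$ to the closed ball); and $x_\phi\colon[s,+\infty)\times B_{s,\delta,\beta}\to X$ is the unique function with $x_\phi(t,\xi)\in E(t)$, $x_\phi(s,\xi)=\xi$, $x_\phi(t,0)=0$, $\|x_\phi(t,\xi)-x_\phi(t,\bar\xi)\|\le C(\mu(t)/\mu(s))^a\nu(s)^\varepsilon\|\xi-\bar\xi\|$ and $x_\phi(t,\xi)=U(t,s)\xi+\int_s^tU(t,r)f\big(r,x_\phi(r,\xi)+\phi(r,x_\phi(r,\xi))\big)\,dr$ for all $t\ge s$ and $\xi,\bar\xi\in B_{s,\delta,\beta}$. *)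

theory Defs
  imports "HOL-Analysis.Analysis"
begin

(* Conventions: functions on [0,oo) are functions on real whose values at negative arguments are
   never used; E(t) x F(t) is identified with X throughout, so a point (x,y) of E(t) x F(t) is
   passed to maps on X as x + y. *)

(* T(t,s) v_s is the value at t of the solution of v' = A(t) v, v(s) = v_s, on [0,oo). *)
definition evolution_operator ::
  "(real \<Rightarrow> 'a::banach \<Rightarrow>\<^sub>L 'a) \<Rightarrow> (real \<Rightarrow> real \<Rightarrow> 'a \<Rightarrow>\<^sub>L 'a) \<Rightarrow> bool" where
  "evolution_operator A T \<longleftrightarrow>
     (\<forall>s\<ge>0. \<forall>v\<^sub>s. blinfun_apply (T s s) v\<^sub>s = v\<^sub>s \<and>
       (\<forall>t\<ge>0. ((\<lambda>t. blinfun_apply (T t s) v\<^sub>s) has_vector_derivative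
                 blinfun_apply (A t) (blinfun_apply (T t s) v\<^sub>s)) (at t within {0..})))"

definition growth_rate :: "(real \<Rightarrow> real) \<Rightarrow> bool" where
  "growth_rate \<mu> \<longleftrightarrow>
     mono_on {0..} \<mu> \<and> (\<forall>t\<ge>0. 1 \<le> \<mu> t) \<and> \<mu> 0 = 1 \<and> filterlim \<mu> at_top at_top"

definition blinfun_inverse :: "('a::banach \<Rightarrow>\<^sub>L 'a) \<Rightarrow> 'a \<Rightarrow>\<^sub>L 'a" where
  "blinfun_inverse L = (THE M. M o\<^sub>L L = id_blinfun \<and> L o\<^sub>L M = id_blinfun)"

definition compl_proj :: "(real \<Rightarrow> 'a::banach \<Rightarrow>\<^sub>L 'a) \<Rightarrow> real \<Rightarrow> 'a \<Rightarrow>\<^sub>L 'a" where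
  "compl_proj P t = id_blinfun - P t"

definition nonuniform_dichotomy ::
  "(real \<Rightarrow> real \<Rightarrow> 'a::banach \<Rightarrow>\<^sub>L 'a) \<Rightarrow> (real \<Rightarrow> 'a \<Rightarrow>\<^sub>L 'a) \<Rightarrow> (real \<Rightarrow> real) \<Rightarrow> (real \<Rightarrow> real)
     \<Rightarrow> real \<Rightarrow> real \<Rightarrow> real \<Rightarrow> real \<Rightarrow> bool" where
  "nonuniform_dichotomy T P \<mu> \<nu> D a b \<epsilon> \<longleftrightarrow>
     (\<forall>t\<ge>0. P t o\<^sub>L P t = P t) \<and>
     (\<forall>t\<ge>0. \<forall>s\<ge>0. P t o\<^sub>L T t s = T t s o\<^sub>L P s) \<and>
     (\<forall>s\<ge>0. \<forall>t\<ge>s.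
        norm (T t s o\<^sub>L P s) \<le> D * (\<mu> t / \<mu> s) powr a * \<nu> s powr \<epsilon> \<and>
        norm (blinfun_inverse (T t s) o\<^sub>L compl_proj P t)
          \<le> D * (\<mu> t / \<mu> s) powr (- b) * \<nu> t powr \<epsilon>)"

definition E_space :: "(real \<Rightarrow> 'a::banach \<Rightarrow>\<^sub>L 'a) \<Rightarrow> real \<Rightarrow> 'a set" where
  "E_space P t = range (blinfun_apply (P t))"

definition F_space :: "(real \<Rightarrow> 'a::banach \<Rightarrow>\<^sub>L 'a) \<Rightarrow> real \<Rightarrow> 'a set" where
  "F_space P t = range (blinfun_apply (compl_proj P t))"

definition U_op ::
  "(real \<Rightarrow> real \<Rightarrow> 'a::banach \<Rightarrow>\<^sub>L 'a) \<Rightarrow> (real \<Rightarrow> 'a \<Rightarrow>\<^sub>L 'a) \<Rightarrow> real \<Rightarrow> real \<Rightarrow> 'a \<Rightarrow>\<^sub>L 'a" where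
  "U_op T P t s = P t o\<^sub>L T t s o\<^sub>L P s"

(* The inverse of V(t,s) = Q(t) T(t,s) Q(s), as a map from F(t) to F(s), composed with Q(t). *)
definition V_inv ::
  "(real \<Rightarrow> real \<Rightarrow> 'a::banach \<Rightarrow>\<^sub>L 'a) \<Rightarrow> (real \<Rightarrow> 'a \<Rightarrow>\<^sub>L 'a) \<Rightarrow> real \<Rightarrow> real \<Rightarrow> 'a \<Rightarrow>\<^sub>L 'a" where
  "V_inv T P t s = blinfun_inverse (T t s) o\<^sub>L compl_proj P t"

definition pert_class :: "real \<Rightarrow> real \<Rightarrow> (real \<Rightarrow> 'a::banach \<Rightarrow> 'a) set" where
  "pert_class c q = {f. \<forall>t\<ge>0. f t 0 = 0 \<and>
     (\<forall>u v. norm (f t u - f t v) \<le> c * norm (u - v) * (norm u + norm v) powr q)}"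

(* Suprema of distances are taken in [0,oo], where the supremum of the empty set is 0. *)
definition pert_dist :: "real \<Rightarrow> (real \<Rightarrow> 'a::banach \<Rightarrow> 'a) \<Rightarrow> (real \<Rightarrow> 'a \<Rightarrow> 'a) \<Rightarrow> ennreal" where
  "pert_dist q f g =
     (SUP (t, u) \<in> {0..} \<times> (UNIV - {0}). ennreal (norm (f t u - g t u) / norm u powr (q + 1)))"

definition forward_interval :: "real \<Rightarrow> ereal \<Rightarrow> real set" where
  "forward_interval s \<omega> = {t. s \<le> t \<and> ereal t < \<omega>}"

definition forward_solution ::
  "(real \<Rightarrow> 'a::banach \<Rightarrow>\<^sub>L 'a) \<Rightarrow> (real \<Rightarrow> 'a \<Rightarrow> 'a) \<Rightarrow> real \<Rightarrow> 'a \<Rightarrow> ereal \<Rightarrow> (real \<Rightarrow> 'a) \<Rightarrow> bool" where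
  "forward_solution A f s v\<^sub>s \<omega> v \<longleftrightarrow>
     ereal s < \<omega> \<and> v s = v\<^sub>s \<and>
     (\<forall>t \<in> forward_interval s \<omega>.
        (v has_vector_derivative (blinfun_apply (A t) (v t) + f t (v t)))
          (at t within forward_interval s \<omega>))"

definition maximal_solution ::
  "(real \<Rightarrow> 'a::banach \<Rightarrow>\<^sub>L 'a) \<Rightarrow> (real \<Rightarrow> 'a \<Rightarrow> 'a) \<Rightarrow> real \<Rightarrow> 'a \<Rightarrow> ereal \<Rightarrow> (real \<Rightarrow> 'a) \<Rightarrow> bool" where
  "maximal_solution A f s v\<^sub>s \<omega> v \<longleftrightarrow>
     forward_solution A f s v\<^sub>s \<omega> v \<and>
     (\<forall>\<omega>' w. forward_solution A f s v\<^sub>s \<omega>' w \<longrightarrow>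
        \<omega>' \<le> \<omega> \<and> (\<forall>t \<in> forward_interval s \<omega>'. w t = v t))"

definition uniquely_solvable ::
  "(real \<Rightarrow> 'a::banach \<Rightarrow>\<^sub>L 'a) \<Rightarrow> (real \<Rightarrow> 'a \<Rightarrow> 'a) \<Rightarrow> bool" where
  "uniquely_solvable A f \<longleftrightarrow> (\<forall>s\<ge>0. \<forall>v\<^sub>s. \<exists>\<omega> v. maximal_solution A f s v\<^sub>s \<omega> v)"

(* Psi A P f tau p p' says that Psi_tau is defined at p = (s,xi,eta) and has the value p';
   Psi_tau is a partial map because solutions need not exist up to time s + tau. *)
definition Psi ::
  "(real \<Rightarrow> 'a::banach \<Rightarrow>\<^sub>L 'a) \<Rightarrow> (real \<Rightarrow> 'a \<Rightarrow>\<^sub>L 'a) \<Rightarrow> (real \<Rightarrow> 'a \<Rightarrow> 'a) \<Rightarrow> real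
     \<Rightarrow> real \<times> 'a \<times> 'a \<Rightarrow> real \<times> 'a \<times> 'a \<Rightarrow> bool" where
  "Psi A P f \<tau> = (\<lambda>(s, \<xi>, \<eta>) p'. \<exists>\<omega> v. maximal_solution A f s (\<xi> + \<eta>) \<omega> v \<and> ereal (s + \<tau>) < \<omega> \<and>
     p' = (s + \<tau>, blinfun_apply (P (s + \<tau>)) (v (s + \<tau>)),
                  blinfun_apply (compl_proj P (s + \<tau>)) (v (s + \<tau>))))"

definition beta_fun ::
  "(real \<Rightarrow> real) \<Rightarrow> (real \<Rightarrow> real) \<Rightarrow> real \<Rightarrow> real \<Rightarrow> real \<Rightarrow> real \<Rightarrow> real" where
  "beta_fun \<mu> \<nu> a \<epsilon> q t = \<mu> t powr a /
     (\<nu> t powr (\<epsilon> * (1 + 1 / q)) *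
      (integral {t..} (\<lambda>r. \<mu> r powr (a * q) * \<nu> r powr \<epsilon>)) powr (1 / q))"

definition beta_tilde ::
  "(real \<Rightarrow> real) \<Rightarrow> (real \<Rightarrow> real) \<Rightarrow> real \<Rightarrow> real \<Rightarrow> real \<Rightarrow> real \<Rightarrow> real" where
  "beta_tilde \<mu> \<nu> a \<epsilon> q t = beta_fun \<mu> \<nu> a \<epsilon> q t * \<nu> t powr (- \<epsilon>)"

definition B_ball ::
  "(real \<Rightarrow> 'a::banach \<Rightarrow>\<^sub>L 'a) \<Rightarrow> real \<Rightarrow> (real \<Rightarrow> real) \<Rightarrow> real \<Rightarrow> 'a set" where
  "B_ball P \<delta> \<beta> s = {\<xi> \<in> E_space P s. norm \<xi> < \<delta> * \<beta> s}"

definition G_set ::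
  "(real \<Rightarrow> 'a::banach \<Rightarrow>\<^sub>L 'a) \<Rightarrow> real \<Rightarrow> (real \<Rightarrow> real) \<Rightarrow> (real \<times> 'a) set" where
  "G_set P \<delta> \<beta> = (SIGMA s:{0..}. B_ball P \<delta> \<beta> s)"

definition X_space ::
  "(real \<Rightarrow> 'a::banach \<Rightarrow>\<^sub>L 'a) \<Rightarrow> real \<Rightarrow> (real \<Rightarrow> real) \<Rightarrow> (real \<Rightarrow> 'a \<Rightarrow> 'a) set" where
  "X_space P \<delta> \<beta> = {\<phi>. \<forall>s\<ge>0.
     \<phi> s 0 = 0 \<and>
     (\<forall>\<xi> \<in> B_ball P \<delta> \<beta> s. \<phi> s \<xi> \<in> F_space P s) \<and>
     (\<forall>\<xi> \<in> B_ball P \<delta> \<beta> s. \<forall>\<xi>' \<in> B_ball P \<delta> \<beta> s. norm (\<phi> s \<xi> - \<phi> s \<xi>') \<le> norm (\<xi> - \<xi>'))}"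

definition X_dist ::
  "(real \<Rightarrow> 'a::banach \<Rightarrow>\<^sub>L 'a) \<Rightarrow> real \<Rightarrow> (real \<Rightarrow> real)
     \<Rightarrow> (real \<Rightarrow> 'a \<Rightarrow> 'a) \<Rightarrow> (real \<Rightarrow> 'a \<Rightarrow> 'a) \<Rightarrow> ennreal" where
  "X_dist P \<delta> \<beta> \<phi> \<psi> =
     (SUP (s, \<xi>) \<in> {(s, \<xi>) \<in> G_set P \<delta> \<beta>. \<xi> \<noteq> 0}. ennreal (norm (\<phi> s \<xi> - \<psi> s \<xi>) / norm \<xi>))"

definition V_graph ::
  "(real \<Rightarrow> 'a::banach \<Rightarrow>\<^sub>L 'a) \<Rightarrow> (real \<Rightarrow> 'a \<Rightarrow> 'a) \<Rightarrow> real \<Rightarrow> (real \<Rightarrow> real) \<Rightarrow> (real \<times> 'a \<times> 'a) set" where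
  "V_graph P \<phi> \<delta> \<beta> = {(s, \<xi>, \<phi> s \<xi>) | s \<xi>. (s, \<xi>) \<in> G_set P \<delta> \<beta>}"

(* Outside the open ball, the value at the radial projection onto the sphere of radius
   delta * beta(s); on the sphere itself, the Lipschitz extension of phi(s,.) to the closed ball is
   given by its limit from inside the ball. *)
definition extend ::
  "(real \<Rightarrow> 'a::banach \<Rightarrow>\<^sub>L 'a) \<Rightarrow> real \<Rightarrow> (real \<Rightarrow> real) \<Rightarrow> (real \<Rightarrow> 'a \<Rightarrow> 'a) \<Rightarrow> real \<Rightarrow> 'a \<Rightarrow> 'a" where
  "extend P \<delta> \<beta> \<phi> s \<xi> =
     (if \<xi> \<in> B_ball P \<delta> \<beta> s then \<phi> s \<xi>
      else Lim (at ((\<delta> * \<beta> s / norm \<xi>) *\<^sub>R \<xi>) within B_ball P \<delta> \<beta> s) (\<phi> s))"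

definition is_x_phi ::
  "(real \<Rightarrow> real \<Rightarrow> 'a::banach \<Rightarrow>\<^sub>L 'a) \<Rightarrow> (real \<Rightarrow> 'a \<Rightarrow>\<^sub>L 'a) \<Rightarrow> (real \<Rightarrow> real) \<Rightarrow> (real \<Rightarrow> real)
     \<Rightarrow> real \<Rightarrow> real \<Rightarrow> real \<Rightarrow> real \<Rightarrow> (real \<Rightarrow> real) \<Rightarrow> (real \<Rightarrow> 'a \<Rightarrow> 'a) \<Rightarrow> (real \<Rightarrow> 'a \<Rightarrow> 'a)
     \<Rightarrow> real \<Rightarrow> (real \<Rightarrow> 'a \<Rightarrow> 'a) \<Rightarrow> bool" where
  "is_x_phi T P \<mu> \<nu> a \<epsilon> C \<delta> \<beta> f \<phi> s x \<longleftrightarrow>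
     (\<forall>\<xi> \<in> B_ball P \<delta> \<beta> s. x s \<xi> = \<xi>) \<and>
     (\<forall>t\<ge>s.
        x t 0 = 0 \<and>
        (\<forall>\<xi> \<in> B_ball P \<delta> \<beta> s. x t \<xi> \<in> E_space P t) \<and>
        (\<forall>\<xi> \<in> B_ball P \<delta> \<beta> s. \<forall>\<xi>' \<in> B_ball P \<delta> \<beta> s.
           norm (x t \<xi> - x t \<xi>') \<le> C * (\<mu> t / \<mu> s) powr a * \<nu> s powr \<epsilon> * norm (\<xi> - \<xi>')) \<and>
        (\<forall>\<xi> \<in> B_ball P \<delta> \<beta> s.
           ((\<lambda>r. blinfun_apply (U_op T P t r) (f r (x r \<xi> + extend P \<delta> \<beta> \<phi> r (x r \<xi>))))
              has_integral (x t \<xi> - blinfun_apply (U_op T P t s) \<xi>)) {s..t}))"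

definition phi_equation ::
  "(real \<Rightarrow> real \<Rightarrow> 'a::banach \<Rightarrow>\<^sub>L 'a) \<Rightarrow> (real \<Rightarrow> 'a \<Rightarrow>\<^sub>L 'a) \<Rightarrow> (real \<Rightarrow> real) \<Rightarrow> (real \<Rightarrow> real)
     \<Rightarrow> real \<Rightarrow> real \<Rightarrow> real \<Rightarrow> real \<Rightarrow> (real \<Rightarrow> real) \<Rightarrow> (real \<Rightarrow> 'a \<Rightarrow> 'a) \<Rightarrow> (real \<Rightarrow> 'a \<Rightarrow> 'a) \<Rightarrow> bool" where
  "phi_equation T P \<mu> \<nu> a \<epsilon> C \<delta> \<beta> f \<phi> \<longleftrightarrow>
     (\<forall>s\<ge>0. \<exists>x. is_x_phi T P \<mu> \<nu> a \<epsilon> C \<delta> \<beta> f \<phi> s x \<and>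
        (\<forall>\<xi> \<in> B_ball P \<delta> \<beta> s.
           ((\<lambda>r. blinfun_apply (V_inv T P r s) (f r (x r \<xi> + extend P \<delta> \<beta> \<phi> r (x r \<xi>))))
              has_integral (- \<phi> s \<xi>)) {s..}))"

(* The function phi of the stable manifold theorem for the perturbation f. The invariance property
   involves phi only along forward orbits starting over the smaller set G, so it does not by itself
   determine phi on all of G_set P delta beta; the integral equation does. *)
definition stable_manifold_function ::
  "(real \<Rightarrow> 'a::banach \<Rightarrow>\<^sub>L 'a) \<Rightarrow> (real \<Rightarrow> real \<Rightarrow> 'a \<Rightarrow>\<^sub>L 'a) \<Rightarrow> (real \<Rightarrow> 'a \<Rightarrow>\<^sub>L 'a)
     \<Rightarrow> (real \<Rightarrow> real) \<Rightarrow> (real \<Rightarrow> real) \<Rightarrow> real \<Rightarrow> real \<Rightarrow> real \<Rightarrow> real \<Rightarrow> real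
     \<Rightarrow> (real \<Rightarrow> 'a \<Rightarrow> 'a) \<Rightarrow> (real \<Rightarrow> 'a \<Rightarrow> 'a) \<Rightarrow> bool" where
  "stable_manifold_function A T P \<mu> \<nu> a \<epsilon> q C \<delta> f \<phi> \<longleftrightarrow>
     \<phi> \<in> X_space P \<delta> (beta_fun \<mu> \<nu> a \<epsilon> q) \<and>
     (\<forall>\<tau>\<ge>0. \<forall>p \<in> V_graph P \<phi> (\<delta> / C) (beta_tilde \<mu> \<nu> a \<epsilon> q).
        \<exists>p' \<in> V_graph P \<phi> \<delta> (beta_fun \<mu> \<nu> a \<epsilon> q). Psi A P f \<tau> p p') \<and>
     phi_equation T P \<mu> \<nu> a \<epsilon> C \<delta> (beta_fun \<mu> \<nu> a \<epsilon> q) f \<phi>"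

end

theory Submission
  imports Defs
begin

text \<open>Let \<open>Z\<close> bound both \<open>\<parallel>\<phi>(s,\<xi>) - \<psi>(s,\<xi>)\<parallel>\<close> relative to \<open>\<parallel>\<xi>\<parallel>\<close> and the distance of the
  trajectories \<open>x\<^sub>\<phi>\<close>, \<open>x\<^sub>\<psi>\<close> relative to \<open>C (\<mu>(t)/\<mu>(s))\<^sup>a \<nu>(s)\<^sup>\<epsilon> \<parallel>\<xi>\<parallel>\<close>; the a priori bounds allow
  \<open>Z = 2\<close>. Inserting such a \<open>Z\<close> into the two integral equations shows, for small \<open>\<delta>\<close>, that
  \<open>Z/2 + k \<parallel>f - g\<parallel>'\<close> is again a bound for both quantities, so the least \<open>Z\<close> is at most
  \<open>2 k \<parallel>f - g\<parallel>'\<close>. Since the trajectories may leave the domain of \<open>\<phi>\<close>, this needs the radial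
  extension of \<open>\<phi>\<close>, which is 2-Lipschitz in an arbitrary Banach space.\<close>

section \<open>Radial retraction onto a ball of a normed space\<close>

definition radial_retract :: "real \<Rightarrow> 'a::real_normed_vector \<Rightarrow> 'a" where
  "radial_retract R x = (if norm x < R then x else (R / norm x) *\<^sub>R x)"

lemma norm_radial_retract_le: "0 < R \<Longrightarrow> norm (radial_retract R x) \<le> R"
  by (auto simp: radial_retract_def)

lemma norm_radial_retract_le_self: "0 < R \<Longrightarrow> norm (radial_retract R x) \<le> norm x"
  by (auto simp: radial_retract_def)

text \<open>If the longer vector lies outside the open ball, pass through the shorter vector scaled
  by the factor \<open>R / norm y\<close> of the longer one. Changing the factor of the shorter
  vector costs at most the difference of the norms, and the common factor is at most 1, so each part
  is at most \<open>norm (x - y)\<close>.\<close>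

lemma radial_retract_lipschitz:
  assumes "0 < R"
  shows "norm (radial_retract R x - radial_retract R y) \<le> 2 * norm (x - y)"
proof -
  have *: "norm (radial_retract R x - radial_retract R y) \<le> 2 * norm (x - y)"
    if le: "norm x \<le> norm y" for x y :: 'a
  proof (cases "norm y < R")
    case True
    then show ?thesis using le by (simp add: radial_retract_def)
  next
    case False
    then have y: "R \<le> norm y" "0 < norm y" using assms by auto
    have ny: "norm y - norm x \<le> norm (x - y)"
      by (metis norm_minus_commute norm_triangle_ineq2)
    have k: "radial_retract R y = (R / norm y) *\<^sub>R y" using False by (simp add: radial_retract_def)
    define k where "k = (if norm x < R then 1 else R / norm x)"
    have kx: "radial_retract R x = k *\<^sub>R x" by (simp add: radial_retract_def k_def)
    have kge: "R / norm y \<le> k"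
      using y le assms by (auto simp: k_def intro!: divide_left_mono mult_pos_pos)
    have "norm (k *\<^sub>R x - (R / norm y) *\<^sub>R x) = (k - R / norm y) * norm x"
      using kge by (simp flip: scaleR_diff_left)
    also have "\<dots> \<le> norm y - norm x"
    proof (cases "norm x < R")
      case True
      have "norm x * (norm y - R) \<le> norm y * (norm y - norm x)"
        using True le y assms by (intro mult_mono) auto
      then show ?thesis using True y by (simp add: k_def field_simps)
    next
      case False
      then have "0 < norm x" using assms by linarith
      then have "(k - R / norm y) * norm x = R / norm y * (norm y - norm x)"
        using False y by (simp add: k_def field_simps)
      also have "\<dots> \<le> 1 * (norm y - norm x)"
        using y le by (intro mult_right_mono) auto
      finally show ?thesis by simp
    qed
    finally have 1: "norm (k *\<^sub>R x - (R / norm y) *\<^sub>R x) \<le> norm (x - y)" using ny by linarith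
    have "norm ((R / norm y) *\<^sub>R x - (R / norm y) *\<^sub>R y) = (R / norm y) * norm (x - y)"
      using assms y by (simp flip: scaleR_diff_right)
    also have "\<dots> \<le> 1 * norm (x - y)"
      using y by (intro mult_right_mono) auto
    finally have 2: "norm ((R / norm y) *\<^sub>R x - (R / norm y) *\<^sub>R y) \<le> norm (x - y)" by simp
    show ?thesis
      using norm_triangle_ineq[of "k *\<^sub>R x - (R / norm y) *\<^sub>R x" "(R / norm y) *\<^sub>R x - (R / norm y) *\<^sub>R y"]
        1 2 by (simp add: k kx)
  qed
  show ?thesis
    using *[of x y] *[of y x] by (cases "norm x \<le> norm y") (auto simp: norm_minus_commute)
qed

section \<open>Balls in \<open>E(s)\<close> and the radial extension of graph functions\<close>

lemma E_space_scaleR: "x \<in> E_space P s \<Longrightarrow> r *\<^sub>R x \<in> E_space P s"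
  by (auto simp: E_space_def simp flip: blinfun.scaleR_right)

lemma radial_retract_in_E: "x \<in> E_space P s \<Longrightarrow> radial_retract R x \<in> E_space P s"
  by (auto simp: radial_retract_def E_space_scaleR)

lemma zero_in_B_ball: "0 < \<delta> * \<beta> s \<Longrightarrow> 0 \<in> B_ball P \<delta> \<beta> s"
  unfolding B_ball_def E_space_def by (auto intro!: range_eqI[of _ _ 0] simp: blinfun.zero_right)

lemma X_space_norm_le:
  assumes "\<phi> \<in> X_space P \<delta> \<beta>" "0 \<le> s" "\<xi> \<in> B_ball P \<delta> \<beta> s"
  shows "norm (\<phi> s \<xi>) \<le> norm \<xi>"
proof -
  have "0 < \<delta> * \<beta> s" using assms(3) by (smt (verit) B_ball_def mem_Collect_eq norm_ge_zero)
  from zero_in_B_ball[where \<beta>=\<beta>, OF this] show ?thesis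
    using assms unfolding X_space_def by (smt (verit) diff_zero mem_Collect_eq)
qed

text \<open>Values of the radial extension are limits along interior points of the ball, so estimates
  on the open ball carry over without treating its sphere separately.\<close>

definition inner_approx :: "real \<Rightarrow> 'a::real_normed_vector \<Rightarrow> nat \<Rightarrow> 'a" where
  "inner_approx R x n = (real n / real (Suc n)) *\<^sub>R radial_retract R x"

lemma inner_approx_in_B_ball:
  assumes "0 < \<delta> * \<beta> s" "x \<in> E_space P s"
  shows "inner_approx (\<delta> * \<beta> s) x n \<in> B_ball P \<delta> \<beta> s"
proof -
  let ?R = "\<delta> * \<beta> s"
  have "norm (inner_approx ?R x n) \<le> real n / real (Suc n) * ?R"
    unfolding inner_approx_def using norm_radial_retract_le[OF assms(1), of x]
    by (auto intro!: mult_left_mono divide_right_mono)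
  also have "\<dots> < ?R" using assms(1) by (simp add: field_simps)
  finally show ?thesis
    using assms(2) by (simp add: B_ball_def inner_approx_def E_space_scaleR radial_retract_in_E)
qed

lemma inner_approx_tendsto: "inner_approx R x \<longlonglongrightarrow> radial_retract R x"
proof -
  have "(\<lambda>n. (real n / real (Suc n)) *\<^sub>R radial_retract R x) \<longlonglongrightarrow> 1 *\<^sub>R radial_retract R x"
    by (intro tendsto_scaleR LIMSEQ_n_over_Suc_n tendsto_const)
  then show ?thesis by (simp add: inner_approx_def[abs_def])
qed

lemma norm_inner_approx_le: "0 < R \<Longrightarrow> norm (inner_approx R x n) \<le> norm x"
proof -
  assume R: "0 < R"
  have "norm (inner_approx R x n) \<le> 1 * norm (radial_retract R x)"
    unfolding inner_approx_def norm_scaleR by (intro mult_right_mono) auto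
  then show ?thesis using norm_radial_retract_le_self[OF R, of x] by linarith
qed

lemma inner_approx_lipschitz:
  "0 < R \<Longrightarrow> norm (inner_approx R x n - inner_approx R y n) \<le> 2 * norm (x - y)"
proof -
  assume R: "0 < R"
  have "norm (inner_approx R x n - inner_approx R y n)
      = real n / real (Suc n) * norm (radial_retract R x - radial_retract R y)"
    unfolding inner_approx_def by (simp flip: scaleR_diff_right)
  also have "\<dots> \<le> 1 * norm (radial_retract R x - radial_retract R y)"
    by (intro mult_right_mono) auto
  finally show ?thesis using radial_retract_lipschitz[OF R, of x y] by linarith
qed

text \<open>On the ball this is continuity. Outside, the points approach the sphere from inside,
  where the Lipschitz function has a limit because the space is complete, and that limit is the
  value chosen by \<open>extend\<close>.\<close>

lemma extend_tendsto:
  assumes phi: "\<phi> \<in> X_space P \<delta> \<beta>" and s: "0 \<le> s" and R: "0 < \<delta> * \<beta> s" and x: "x \<in> E_space P s"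
  shows "(\<lambda>n. \<phi> s (inner_approx (\<delta> * \<beta> s) x n)) \<longlonglongrightarrow> extend P \<delta> \<beta> \<phi> s x"
proof -
  let ?B = "B_ball P \<delta> \<beta> s" and ?R = "\<delta> * \<beta> s"
  let ?a = "inner_approx ?R x" and ?p = "radial_retract ?R x"
  have lip: "norm (\<phi> s u - \<phi> s v) \<le> norm (u - v)" if "u \<in> ?B" "v \<in> ?B" for u v
    using phi s that by (auto simp: X_space_def)
  have uc: "uniformly_continuous_on ?B (\<phi> s)"
    unfolding uniformly_continuous_on_def dist_norm using lip by (meson order_le_less_trans)
  have aB: "\<And>n. ?a n \<in> ?B" by (rule inner_approx_in_B_ball[where \<beta>=\<beta>, OF R x])
  show ?thesis
  proof (cases "x \<in> ?B")
    case True
    then have "norm x < ?R" by (simp add: B_ball_def)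
    then have p: "?p = x" by (simp add: radial_retract_def)
    have "continuous_on ?B (\<phi> s)" using uc by (rule uniformly_continuous_imp_continuous)
    then have "(\<lambda>n. \<phi> s (?a n)) \<longlonglongrightarrow> \<phi> s x"
      using inner_approx_tendsto[of ?R x] aB True unfolding continuous_on_sequentially p o_def
      by blast
    then show ?thesis using True by (simp add: extend_def)
  next
    case False
    then have nx: "?R \<le> norm x" using x by (auto simp: B_ball_def)
    then have p: "?p = (?R / norm x) *\<^sub>R x" by (simp add: radial_retract_def)
    have np: "norm ?p = ?R" using nx R p by auto
    \<comment> \<open>The filter \<open>at ?p\<close> ignores \<open>?p\<close> itself; interior
      points have norm below \<open>?R\<close>, so the sequence never meets it.\<close>
    have "?a n \<noteq> ?p" for n
      using aB[of n] np by (auto simp: B_ball_def)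
    then have lim: "filterlim ?a (at ?p within ?B) sequentially"
      using inner_approx_tendsto[of ?R x] aB by (auto simp: filterlim_at)
    \<comment> \<open>\<open>Lim\<close> denotes the limit only along a nontrivial filter, and the
      sequence just found shows that this one is.\<close>
    then have nt: "at ?p within ?B \<noteq> bot"
      by (metis filterlim_def le_bot filtermap_bot_iff trivial_limit_sequentially)
    have "?p \<in> closure ?B"
      using aB inner_approx_tendsto[of ?R x] closure_sequential by blast
    then obtain l where l: "(\<phi> s \<longlongrightarrow> l) (at ?p within ?B)"
      using uniformly_continuous_on_extension_at_closure[OF uc] by blast
    have "extend P \<delta> \<beta> \<phi> s x = l"
      using False tendsto_Lim[OF nt l] by (simp add: extend_def p)
    then show ?thesis using filterlim_compose[OF l lim] by simp
  qed
qed

text \<open>The factor 2 comes from the retraction alone, since \<open>\<phi> s\<close> has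
  Lipschitz constant 1 on the ball.\<close>

lemma extend_lipschitz:
  assumes "\<phi> \<in> X_space P \<delta> \<beta>" "0 \<le> s" "0 < \<delta> * \<beta> s" "x \<in> E_space P s" "y \<in> E_space P s"
  shows "norm (extend P \<delta> \<beta> \<phi> s x - extend P \<delta> \<beta> \<phi> s y) \<le> 2 * norm (x - y)"
proof -
  let ?a = "inner_approx (\<delta> * \<beta> s)"
  have "norm (\<phi> s (?a x n) - \<phi> s (?a y n)) \<le> norm (?a x n - ?a y n)" for n
    using assms inner_approx_in_B_ball[of \<delta> \<beta> s _ P n] unfolding X_space_def by blast
  then have "norm (\<phi> s (?a x n) - \<phi> s (?a y n)) \<le> 2 * norm (x - y)" for n
    using inner_approx_lipschitz[OF assms(3), of x n y] order_trans by blast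
  then show ?thesis
    using assms by (intro Lim_norm_ubound[OF _ tendsto_diff[OF extend_tendsto extend_tendsto]]) auto
qed

lemma norm_extend_le:
  assumes "\<phi> \<in> X_space P \<delta> \<beta>" "0 \<le> s" "0 < \<delta> * \<beta> s" "x \<in> E_space P s"
  shows "norm (extend P \<delta> \<beta> \<phi> s x) \<le> norm x"
proof -
  have "norm (\<phi> s (inner_approx (\<delta> * \<beta> s) x n)) \<le> norm x" for n
    using X_space_norm_le[OF assms(1,2) inner_approx_in_B_ball[where \<beta>=\<beta>, OF assms(3,4)]]
      norm_inner_approx_le[OF assms(3)] order_trans by blast
  then show ?thesis
    using assms by (intro Lim_norm_ubound[OF _ extend_tendsto]) auto
qed

text \<open>Transfers a relative distance of two graphs from the open ball to all of
  \<open>E(s)\<close> without loss, because the inner approximations are no longer than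
  \<open>x\<close>.\<close>

lemma extend_diff_le:
  assumes "\<phi> \<in> X_space P \<delta> \<beta>" "\<psi> \<in> X_space P \<delta> \<beta>" "0 \<le> s" "0 < \<delta> * \<beta> s" "x \<in> E_space P s"
    and "0 \<le> L" and L: "\<And>\<xi>. \<xi> \<in> B_ball P \<delta> \<beta> s \<Longrightarrow> norm (\<phi> s \<xi> - \<psi> s \<xi>) \<le> L * norm \<xi>"
  shows "norm (extend P \<delta> \<beta> \<phi> s x - extend P \<delta> \<beta> \<psi> s x) \<le> L * norm x"
proof -
  let ?a = "inner_approx (\<delta> * \<beta> s) x"
  have "norm (\<phi> s (?a n) - \<psi> s (?a n)) \<le> L * norm x" for n
    using L[OF inner_approx_in_B_ball[where \<beta>=\<beta> and n=n, OF assms(4,5)]]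
      mult_left_mono[OF norm_inner_approx_le[OF assms(4), of x n] assms(6)] order_trans by blast
  then show ?thesis
    using assms by (intro Lim_norm_ubound[OF _ tendsto_diff[OF extend_tendsto extend_tendsto]]) auto
qed

section \<open>Selecting trajectories and comparing perturbations\<close>

text \<open>\<open>phi_equation\<close> provides trajectories separately for each initial time; a
  choice makes them one family \<open>x\<close>, so that a supremum over all initial times can be
  formed.\<close>

lemma phi_equation_choice:
  assumes "phi_equation T P \<mu> \<nu> a \<epsilon> C \<delta> \<beta> f \<phi>"
  obtains x where "\<And>s. 0 \<le> s \<Longrightarrow> is_x_phi T P \<mu> \<nu> a \<epsilon> C \<delta> \<beta> f \<phi> s (x s)"
    and "\<And>s \<xi>. 0 \<le> s \<Longrightarrow> \<xi> \<in> B_ball P \<delta> \<beta> s \<Longrightarrow>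
      ((\<lambda>r. blinfun_apply (V_inv T P r s) (f r (x s r \<xi> + extend P \<delta> \<beta> \<phi> r (x s r \<xi>))))
        has_integral (- \<phi> s \<xi>)) {s..}"
proof -
  let ?Q = "\<lambda>s x. is_x_phi T P \<mu> \<nu> a \<epsilon> C \<delta> \<beta> f \<phi> s x \<and>
    (\<forall>\<xi> \<in> B_ball P \<delta> \<beta> s.
      ((\<lambda>r. blinfun_apply (V_inv T P r s) (f r (x r \<xi> + extend P \<delta> \<beta> \<phi> r (x r \<xi>))))
        has_integral (- \<phi> s \<xi>)) {s..})"
  have "\<forall>s\<in>{0..}. \<exists>x. ?Q s x" using assms unfolding phi_equation_def by simp
  from bchoice[OF this] obtain x where "\<forall>s\<in>{0..}. ?Q s (x s)" ..
  then show ?thesis using that[of x] by simp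
qed

lemma pert_dist_bound:
  assumes "f \<in> pert_class c q" "g \<in> pert_class c q" "pert_dist q f g = ennreal M" "0 \<le> M" "0 \<le> t"
  shows "norm (f t u - g t u) \<le> M * norm u powr (q + 1)"
\<comment> \<open>The supremum in \<open>pert_dist\<close> omits \<open>u = 0\<close>, where both
  perturbations vanish.\<close>
proof (cases "u = 0")
  case True
  then show ?thesis using assms by (simp add: pert_class_def)
next
  case False
  have "ennreal (norm (f t u - g t u) / norm u powr (q + 1)) \<le> ennreal M"
    unfolding assms(3)[symmetric] pert_dist_def
    using False \<open>0 \<le> t\<close> by (intro SUP_upper2[of "(t, u)"]) auto
  then show ?thesis using False assms(4) by (simp add: pos_divide_le_eq)
qed

text \<open>Passes through \<open>f r v\<close>: the Lipschitz condition on \<open>f\<close> handles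
  the change of the point, and \<open>M\<close> the change of the perturbation. \<open>Y\<close>
  stands for the size of a trajectory; adding the graph over it doubles the norm, and
  \<open>4 * Z * Y\<close> is the displacement found in \<open>integrand_bound\<close>.\<close>

lemma perturbation_difference:
  assumes f: "f \<in> pert_class c q" and r: "0 \<le> r"
    and M: "\<And>u. norm (f r u - g r u) \<le> M * norm u powr (q + 1)"
    and nn: "0 \<le> c" "0 \<le> q" "0 \<le> M" "0 \<le> Y"
    and u: "norm u \<le> 2 * Y" and v: "norm v \<le> 2 * Y" and uv: "norm (u - v) \<le> 4 * Z * Y"
  shows "norm (f r u - g r v) \<le> (c * 4 powr q * (4 * Z) + M * 2 powr (q + 1)) * Y powr (q + 1)"
proof -
  have "norm (f r u - f r v) \<le> c * norm (u - v) * (norm u + norm v) powr q"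
    using f r by (simp add: pert_class_def)
  also have "\<dots> \<le> c * (4 * Z * Y) * (4 * Y) powr q"
    using u v nn mult_nonneg_nonneg[OF nn(1) order_trans[OF norm_ge_zero uv]]
    by (intro mult_mono[OF mult_left_mono[OF uv]] powr_mono2) auto
  also have "\<dots> = c * 4 powr q * (4 * Z) * Y powr (q + 1)"
    using nn by (cases "Y = 0") (auto simp: powr_mult powr_add)
  finally have 1: "norm (f r u - f r v) \<le> c * 4 powr q * (4 * Z) * Y powr (q + 1)" .
  have "norm (f r v - g r v) \<le> M * norm v powr (q + 1)" by (rule M)
  also have "\<dots> \<le> M * (2 * Y) powr (q + 1)"
    using v nn by (intro mult_left_mono powr_mono2) auto
  also have "\<dots> = M * 2 powr (q + 1) * Y powr (q + 1)" using nn by (simp add: powr_mult)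
  finally have 2: "norm (f r v - g r v) \<le> M * 2 powr (q + 1) * Y powr (q + 1)" .
  show ?thesis
    using norm_triangle_ineq[of "f r u - f r v" "f r v - g r v"] 1 2 by (simp add: algebra_simps)
qed

text \<open>The supremum of \<open>S\<close> is finite by the crude bound \<open>B\<close> and is
  itself an admissible \<open>Z\<close>. The step then gives
  \<open>Sup S \<le> Sup S / 2 + k\<close>, where the finite supremum can be absorbed.\<close>

lemma contractive_bound:
  fixes S :: "real set"
  assumes S: "\<And>v. v \<in> S \<Longrightarrow> 0 \<le> v" "\<And>v. v \<in> S \<Longrightarrow> v \<le> B"
    and step: "\<And>Z v. 0 \<le> Z \<Longrightarrow> (\<And>v. v \<in> S \<Longrightarrow> v \<le> Z) \<Longrightarrow> v \<in> S \<Longrightarrow> v \<le> Z / 2 + k"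
    and v: "v \<in> S"
  shows "v \<le> 2 * k"
proof -
  have bdd: "bdd_above S" using S(2) by (rule bdd_aboveI)
  have le: "w \<le> Sup S" if "w \<in> S" for w using that bdd by (rule cSup_upper)
  have "0 \<le> Sup S" using le[OF v] S(1)[OF v] by linarith
  then have "Sup S \<le> Sup S / 2 + k"
    using step le v by (intro cSup_least) auto
  then show ?thesis using le[OF v] by linarith
qed

section \<open>Weighted integrals and operator bounds under the dichotomy\<close>

locale dichotomy =
  fixes T :: "real \<Rightarrow> real \<Rightarrow> 'a::banach \<Rightarrow>\<^sub>L 'a" and P :: "real \<Rightarrow> 'a \<Rightarrow>\<^sub>L 'a"
    and \<mu> \<nu> :: "real \<Rightarrow> real" and q D a b \<epsilon> :: real
  assumes q: "0 < q" and growth: "growth_rate \<mu>" "growth_rate \<nu>"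
    and const: "1 \<le> D" "a < 0" "0 \<le> b" "0 < \<epsilon>"
    and dich: "nonuniform_dichotomy T P \<mu> \<nu> D a b \<epsilon>"
    and integrable: "(\<lambda>r. \<mu> r powr (a * q) * \<nu> r powr \<epsilon>) integrable_on {0..}"
begin

abbreviation weight :: "real \<Rightarrow> real" where
  "weight r \<equiv> \<mu> r powr (a * q) * \<nu> r powr \<epsilon>"

abbreviation \<beta> :: "real \<Rightarrow> real" where "\<beta> \<equiv> beta_fun \<mu> \<nu> a \<epsilon> q"

lemma rate_ge1: "0 \<le> t \<Longrightarrow> 1 \<le> \<mu> t" "0 \<le> t \<Longrightarrow> 1 \<le> \<nu> t"
  using growth by (auto simp: growth_rate_def)

lemma rate_mono: "0 \<le> s \<Longrightarrow> s \<le> t \<Longrightarrow> \<mu> s \<le> \<mu> t"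
  using growth by (auto simp: growth_rate_def mono_on_def)

lemma rate_pos: "0 \<le> t \<Longrightarrow> 0 < \<mu> t" "0 \<le> t \<Longrightarrow> 0 < \<nu> t"
  using rate_ge1 by (auto intro: less_le_trans[OF zero_less_one])

text \<open>A nonnegative integrable function is absolutely integrable, and absolute integrability
  restricts to measurable subsets.\<close>

lemma weight_integrable_tail: "0 \<le> s \<Longrightarrow> weight integrable_on {s..}"
proof -
  assume s: "0 \<le> s"
  have "weight absolutely_integrable_on {0..}"
    using integrable by (rule nonnegative_absolutely_integrable_1) auto
  then have "weight absolutely_integrable_on {s..}"
    by (rule set_integrable_subset) (use s in auto)
  then show ?thesis by (rule set_lebesgue_integral_eq_integral(1))
qed

lemma weight_integrable_interval: "0 \<le> s \<Longrightarrow> weight integrable_on {s..t}"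
proof -
  assume s: "0 \<le> s"
  have "weight absolutely_integrable_on {0..}"
    using integrable by (rule nonnegative_absolutely_integrable_1) auto
  then have "weight absolutely_integrable_on {s..t}"
    by (rule set_integrable_subset) (use s in auto)
  then show ?thesis by (rule set_lebesgue_integral_eq_integral(1))
qed

text \<open>Since \<open>a < 0\<close> and \<open>\<nu>\<close> is at least 1, the weight is at
  least \<open>\<mu> (s + 1) powr (a * q)\<close> on a unit interval. Positivity matters because
  \<open>beta_fun\<close> divides by a power of this tail.\<close>

lemma tail_pos: "0 \<le> s \<Longrightarrow> 0 < integral {s..} weight"
proof -
  assume s: "0 \<le> s"
  have "\<mu> (s + 1) powr (a * q) \<le> weight r" if "r \<in> {s..s+1}" for r
  proof -
    have "\<mu> (s + 1) powr (a * q) * 1 \<le> \<mu> r powr (a * q) * \<nu> r powr \<epsilon>"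
      using that s const q rate_mono[of r "s + 1"] rate_pos[of r] rate_ge1[of r]
      by (intro mult_mono powr_mono2' ge_one_powr_ge_zero) (auto simp: mult_le_0_iff)
    then show ?thesis by simp
  qed
  then have "integral {s..s+1} (\<lambda>_. \<mu> (s + 1) powr (a * q)) \<le> integral {s..s+1} weight"
    using s by (intro integral_le weight_integrable_interval) auto
  also have "\<dots> \<le> integral {s..} weight"
    using s by (intro integral_subset_le weight_integrable_interval weight_integrable_tail) auto
  finally show ?thesis using rate_pos[of "s + 1"] s by (auto intro: less_le_trans[rotated])
qed

lemma beta_pos: "0 \<le> s \<Longrightarrow> 0 < \<beta> s"
  using tail_pos[of s] rate_pos[of s] by (auto simp: beta_fun_def)

text \<open>The power \<open>q\<close> undoes the root of the tail integral in
  \<open>\<beta>\<close> and turns the exponent of \<open>\<nu>\<close> into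
  \<open>\<epsilon> * (q + 1)\<close>.\<close>

lemma beta_powr_tail:
  assumes "0 \<le> s"
  shows "\<beta> s powr q * integral {s..} weight = \<mu> s powr (a * q) * \<nu> s powr (- (\<epsilon> * (q + 1)))"
proof -
  have "\<epsilon> * ((1 + 1 / q) * q) = \<epsilon> * (q + 1)" using q by (simp add: field_simps)
  then have "\<beta> s powr q = \<mu> s powr (a * q) / (\<nu> s powr (\<epsilon> * (q + 1)) * integral {s..} weight)"
    using q tail_pos[OF assms] rate_pos[OF assms]
    by (simp only: beta_fun_def powr_divide powr_mult powr_powr mult.assoc) simp
  then show ?thesis
    using tail_pos[OF assms] by (simp add: powr_minus divide_inverse)
qed

lemma B_ball_tail_bound:
  assumes "0 \<le> s" "0 < \<delta>" "\<xi> \<in> B_ball P \<delta> \<beta> s"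
  shows "norm \<xi> powr q * integral {s..} weight
    \<le> \<delta> powr q * (\<mu> s powr (a * q) * \<nu> s powr (- (\<epsilon> * (q + 1))))"
proof -
  have "norm \<xi> powr q \<le> (\<delta> * \<beta> s) powr q"
    using assms q by (intro powr_mono2) (auto simp: B_ball_def)
  then have "norm \<xi> powr q * integral {s..} weight \<le> (\<delta> * \<beta> s) powr q * integral {s..} weight"
    using tail_pos[OF assms(1)] by (intro mult_right_mono) auto
  also have "\<dots> = \<delta> powr q * (\<beta> s powr q * integral {s..} weight)"
    using assms beta_pos[of s] by (simp add: powr_mult)
  finally show ?thesis by (simp only: beta_powr_tail[OF assms(1)])
qed

text \<open>Both shapes of \<open>S\<close> occur: the trajectory equation integrates over an
  interval, the graph equation over a half-line. As the weight is nonnegative, the same tail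
  dominates both.\<close>

lemma weighted_integral_bound:
  fixes h :: "real \<Rightarrow> 'a"
  assumes h: "(h has_integral I) S" and S: "S = {s..} \<or> S = {s..t}" and s: "0 \<le> s"
    and le: "\<And>r. r \<in> S \<Longrightarrow> norm (h r) \<le> k * weight r" and k: "0 \<le> k"
  shows "norm I \<le> k * integral {s..} weight"
proof -
  have wS: "weight integrable_on S"
    using S weight_integrable_tail[OF s] weight_integrable_interval[OF s] by auto
  have "norm (integral S h) \<le> integral S (\<lambda>r. k * weight r)"
    using h le integrable_on_cmult_left[OF wS] by (intro integral_norm_bound_integral) auto
  also have "\<dots> = k * integral S weight" by simp
  also have "\<dots> \<le> k * integral {s..} weight"
    using S k wS weight_integrable_tail[OF s] by (intro mult_left_mono integral_subset_le) auto
  finally show ?thesis using h by (simp add: integral_unique)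
qed

text \<open>The projections commute with \<open>T\<close> and are idempotent, so \<open>U_op\<close>
  reduces to \<open>T t s o\<^sub>L P s\<close>, which the dichotomy bounds.\<close>

lemma norm_U_op_le:
  assumes "0 \<le> s" "s \<le> t"
  shows "norm (U_op T P t s) \<le> D * (\<mu> t / \<mu> s) powr a * \<nu> s powr \<epsilon>"
proof -
  have "P t o\<^sub>L T t s = T t s o\<^sub>L P s" "P s o\<^sub>L P s = P s"
    using dich assms unfolding nonuniform_dichotomy_def by auto
  then have "P t (T t s v) = T t s (P s v)" "P s (P s v) = P s v" for v
    by (metis blinfun_apply_blinfun_compose)+
  then have "U_op T P t s = T t s o\<^sub>L P s"
    unfolding U_op_def by (intro blinfun_eqI) simp
  then show ?thesis using dich assms unfolding nonuniform_dichotomy_def by auto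
qed

lemma norm_V_inv_le:
  assumes "0 \<le> s" "s \<le> t"
  shows "norm (V_inv T P t s) \<le> D * (\<mu> t / \<mu> s) powr (- b) * \<nu> t powr \<epsilon>"
  using dich assms unfolding nonuniform_dichotomy_def V_inv_def by auto

text \<open>The exponents in \<open>\<beta>\<close> are chosen so that integrating against the contraction
  rate over the ball of radius \<open>\<delta> \<beta>(s)\<close> leaves only \<open>\<delta>\<^sup>q\<close>, which is made small, and
  \<open>\<nu>(s)\<^sup>-\<^sup>\<epsilon>\<close>, which cancels the nonuniformity of the rate at the initial time.\<close>

lemma rate_integral_bound:
  fixes h :: "real \<Rightarrow> 'a"
  assumes h: "(h has_integral I) S" and S: "S = {s..} \<or> S = {s..t}" and s: "0 \<le> s"
    and d: "0 < \<delta>" "\<xi> \<in> B_ball P \<delta> \<beta> s" and H: "0 \<le> H" and C: "0 < C"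
    and le: "\<And>r. r \<in> S \<Longrightarrow>
      norm (h r) \<le> H * (C * (\<mu> r / \<mu> s) powr a * \<nu> s powr \<epsilon> * norm \<xi>) powr q * \<nu> r powr \<epsilon>"
  shows "norm I \<le> H * (C powr q * \<delta> powr q * \<nu> s powr (- \<epsilon>))"
proof -
  \<comment> \<open>\<open>k\<close> collects the factors that do not depend on \<open>r\<close>;
    the rest of the bound is exactly \<open>weight r\<close>.\<close>
  define k where "k = H * (C powr q * \<mu> s powr (- (a * q)) * \<nu> s powr (\<epsilon> * q) * norm \<xi> powr q)"
  have k: "0 \<le> k" using H by (simp add: k_def)
  have "norm (h r) \<le> k * weight r" if "r \<in> S" for r
  proof -
    have "0 \<le> r" using that S s by auto
    then show ?thesis
      using le[OF that] rate_pos[of s] rate_pos[of r] s C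
      by (simp add: k_def powr_mult powr_powr powr_divide powr_minus field_simps)
  qed
  then have "norm I \<le> k * integral {s..} weight"
    using weighted_integral_bound[OF h S s _ k] by blast
  also have "\<dots> = H * (C powr q * \<mu> s powr (- (a * q)) * \<nu> s powr (\<epsilon> * q))
      * (norm \<xi> powr q * integral {s..} weight)" by (simp add: k_def)
  also have "\<dots> \<le> H * (C powr q * \<mu> s powr (- (a * q)) * \<nu> s powr (\<epsilon> * q))
      * (\<delta> powr q * (\<mu> s powr (a * q) * \<nu> s powr (- (\<epsilon> * (q + 1)))))"
    using H by (intro mult_left_mono B_ball_tail_bound[OF s d]) auto
  \<comment> \<open>Regrouped so that the powers of \<open>\<mu> s\<close> cancel and the exponents
    of \<open>\<nu> s\<close> add up to \<open>- \<epsilon>\<close>.\<close>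
  also have "\<dots> = H * (C powr q * \<delta> powr q * ((\<mu> s powr (- (a * q)) * \<mu> s powr (a * q))
      * (\<nu> s powr (\<epsilon> * q) * \<nu> s powr (- (\<epsilon> * (q + 1))))))" by (simp add: mult_ac)
  also have "\<dots> = H * (C powr q * \<delta> powr q * \<nu> s powr (- \<epsilon>))"
    using rate_pos[OF s] by (simp add: algebra_simps flip: powr_add)
  finally show ?thesis .
qed

end

section \<open>Comparing the graphs and trajectories of two perturbations\<close>

locale two_perturbations = dichotomy T P \<mu> \<nu> q D a b \<epsilon>
  for T :: "real \<Rightarrow> real \<Rightarrow> 'a::banach \<Rightarrow>\<^sub>L 'a" and P \<mu> \<nu> q D a b \<epsilon> +
  fixes c C \<delta> M :: real and f g \<phi> \<psi> :: "real \<Rightarrow> 'a \<Rightarrow> 'a" and x y :: "real \<Rightarrow> real \<Rightarrow> 'a \<Rightarrow> 'a"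
  assumes c: "0 < c" and DC: "D < C" and \<delta>: "0 < \<delta>"
    and small: "4 * (1 + C) * D * C powr q * \<delta> powr q * c * 4 powr q \<le> 1 / 2"
    and f: "f \<in> pert_class c q"
    and M: "0 \<le> M" "\<And>t u. 0 \<le> t \<Longrightarrow> norm (f t u - g t u) \<le> M * norm u powr (q + 1)"
    and phi: "\<phi> \<in> X_space P \<delta> (beta_fun \<mu> \<nu> a \<epsilon> q)"
    and psi: "\<psi> \<in> X_space P \<delta> (beta_fun \<mu> \<nu> a \<epsilon> q)"
    and x: "\<And>s. 0 \<le> s \<Longrightarrow> is_x_phi T P \<mu> \<nu> a \<epsilon> C \<delta> (beta_fun \<mu> \<nu> a \<epsilon> q) f \<phi> s (x s)"
    and y: "\<And>s. 0 \<le> s \<Longrightarrow> is_x_phi T P \<mu> \<nu> a \<epsilon> C \<delta> (beta_fun \<mu> \<nu> a \<epsilon> q) g \<psi> s (y s)"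
    and phi_eq: "\<And>s \<xi>. 0 \<le> s \<Longrightarrow> \<xi> \<in> B_ball P \<delta> (beta_fun \<mu> \<nu> a \<epsilon> q) s \<Longrightarrow>
      ((\<lambda>r. blinfun_apply (V_inv T P r s)
          (f r (x s r \<xi> + extend P \<delta> (beta_fun \<mu> \<nu> a \<epsilon> q) \<phi> r (x s r \<xi>))))
        has_integral (- \<phi> s \<xi>)) {s..}"
    and psi_eq: "\<And>s \<xi>. 0 \<le> s \<Longrightarrow> \<xi> \<in> B_ball P \<delta> (beta_fun \<mu> \<nu> a \<epsilon> q) s \<Longrightarrow>
      ((\<lambda>r. blinfun_apply (V_inv T P r s)
          (g r (y s r \<xi> + extend P \<delta> (beta_fun \<mu> \<nu> a \<epsilon> q) \<psi> r (y s r \<xi>))))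
        has_integral (- \<psi> s \<xi>)) {s..}"
begin

abbreviation rate :: "real \<Rightarrow> real \<Rightarrow> real" where
  "rate s t \<equiv> C * (\<mu> t / \<mu> s) powr a * \<nu> s powr \<epsilon>"

abbreviation "ball_at \<equiv> B_ball P \<delta> \<beta>"

abbreviation "fx s \<xi> r \<equiv> f r (x s r \<xi> + extend P \<delta> \<beta> \<phi> r (x s r \<xi>))"
abbreviation "gy s \<xi> r \<equiv> g r (y s r \<xi> + extend P \<delta> \<beta> \<psi> r (y s r \<xi>))"

lemma C_pos: "0 < C" using DC const by linarith

lemma radius_pos: "0 \<le> s \<Longrightarrow> 0 < \<delta> * \<beta> s"
  using beta_pos \<delta> by simp

lemma rate_pos': "0 \<le> s \<Longrightarrow> s \<le> t \<Longrightarrow> 0 < rate s t"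
  using C_pos rate_pos[of s] rate_pos[of t] by simp

lemma norm_x_le:
  assumes "0 \<le> s" "s \<le> t" "\<xi> \<in> ball_at s"
  shows "norm (x s t \<xi>) \<le> rate s t * norm \<xi>" "norm (y s t \<xi>) \<le> rate s t * norm \<xi>"
    "x s t \<xi> \<in> E_space P t" "y s t \<xi> \<in> E_space P t"
proof -
  have z: "0 \<in> ball_at s" by (intro zero_in_B_ball radius_pos assms)
  have "norm (x s t \<xi> - x s t 0) \<le> rate s t * norm (\<xi> - 0)" "x s t 0 = 0"
    using x[OF assms(1)] assms z unfolding is_x_phi_def by blast+
  then show "norm (x s t \<xi>) \<le> rate s t * norm \<xi>" by simp
  have "norm (y s t \<xi> - y s t 0) \<le> rate s t * norm (\<xi> - 0)" "y s t 0 = 0"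
    using y[OF assms(1)] assms z unfolding is_x_phi_def by blast+
  then show "norm (y s t \<xi>) \<le> rate s t * norm \<xi>" by simp
  show "x s t \<xi> \<in> E_space P t" "y s t \<xi> \<in> E_space P t"
    using x[OF assms(1)] y[OF assms(1)] assms unfolding is_x_phi_def by blast+
qed

text \<open>The factor produced by \<open>perturbation_difference\<close>: the first summand carries
  the bound \<open>Z\<close> to be improved, the second the distance \<open>M\<close> of the
  perturbations.\<close>

definition J :: "real \<Rightarrow> real" where
  "J Z = c * 4 powr q * (4 * Z) + M * 2 powr (q + 1)"

lemma J_nonneg: "0 \<le> Z \<Longrightarrow> 0 \<le> J Z"
  using c M by (simp add: J_def)

section \<open>One improvement step for a common bound \<open>Z\<close> on graphs and
  trajectories\<close>

context
  fixes Z :: real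
  assumes Z: "0 \<le> Z"
    and Z_phi: "\<And>s \<xi>. 0 \<le> s \<Longrightarrow> \<xi> \<in> ball_at s \<Longrightarrow> norm (\<phi> s \<xi> - \<psi> s \<xi>) \<le> Z * norm \<xi>"
    and Z_x: "\<And>s t \<xi>. 0 \<le> s \<Longrightarrow> s \<le> t \<Longrightarrow> \<xi> \<in> ball_at s \<Longrightarrow>
      norm (x s t \<xi> - y s t \<xi>) \<le> Z * (rate s t * norm \<xi>)"
begin

text \<open>The two points on the extended graphs are joined in three moves: between the
  trajectories in \<open>E(r)\<close>, between the graphs over the first trajectory, and along the
  graph of \<open>\<psi>\<close>, which is 2-Lipschitz. The first and third cost three times the
  trajectory distance, the second one more multiple of \<open>Z\<close>, hence the factor 4.\<close>

lemma integrand_bound: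
  assumes s: "0 \<le> s" "s \<le> r" and \<xi>: "\<xi> \<in> ball_at s"
  shows "norm (fx s \<xi> r - gy s \<xi> r) \<le> J Z * (rate s r * norm \<xi>) powr (q + 1)"
proof -
  let ?e = "extend P \<delta> \<beta>" and ?x = "x s r \<xi>" and ?y = "y s r \<xi>"
  have r: "0 \<le> r" "0 < \<delta> * \<beta> r" using s radius_pos by auto
  note xy = norm_x_le[OF s \<xi>]
  have Y: "0 \<le> rate s r * norm \<xi>" using rate_pos'[OF s] by simp
  have u: "norm (?x + ?e \<phi> r ?x) \<le> 2 * (rate s r * norm \<xi>)"
    using norm_extend_le[OF phi r xy(3)] xy(1) norm_triangle_ineq[of ?x "?e \<phi> r ?x"] by linarith
  have v: "norm (?y + ?e \<psi> r ?y) \<le> 2 * (rate s r * norm \<xi>)"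
    using norm_extend_le[OF psi r xy(4)] xy(2) norm_triangle_ineq[of ?y "?e \<psi> r ?y"] by linarith
  have 1: "norm (?e \<phi> r ?x - ?e \<psi> r ?x) \<le> Z * (rate s r * norm \<xi>)"
    using extend_diff_le[OF phi psi r xy(3) Z Z_phi[OF r(1)]] mult_left_mono[OF xy(1) Z]
    by (rule order_trans)
  have 2: "norm (?e \<psi> r ?x - ?e \<psi> r ?y) \<le> 2 * norm (?x - ?y)"
    by (rule extend_lipschitz[OF psi r xy(3,4)])
  have eq: "?x + ?e \<phi> r ?x - (?y + ?e \<psi> r ?y)
      = (?x - ?y) + (?e \<phi> r ?x - ?e \<psi> r ?x) + (?e \<psi> r ?x - ?e \<psi> r ?y)" by simp
  have "norm (?x + ?e \<phi> r ?x - (?y + ?e \<psi> r ?y)) \<le> 3 * norm (?x - ?y) + Z * (rate s r * norm \<xi>)"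
    unfolding eq using 1 2 norm_triangle_ineq[of "?x - ?y" "?e \<phi> r ?x - ?e \<psi> r ?x"]
      norm_triangle_ineq[of "(?x - ?y) + (?e \<phi> r ?x - ?e \<psi> r ?x)" "?e \<psi> r ?x - ?e \<psi> r ?y"]
    by linarith
  also have "\<dots> \<le> 4 * Z * (rate s r * norm \<xi>)" using Z_x[OF s \<xi>] by linarith
  finally show ?thesis
    unfolding J_def using c q M(1) Y
    by (intro perturbation_difference[where g=g, OF f r(1) M(2)[OF r(1)] _ _ _ _ u v]) auto
qed

text \<open>The linear terms cancel in the difference of the equations. One factor of the power
  \<open>q + 1\<close> combines with \<open>(\<mu> t / \<mu> r) powr a\<close> into the rate at the
  final time and leaves the integral; the remaining power \<open>q\<close> is absorbed by
  \<open>rate_integral_bound\<close>.\<close>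

lemma x_step:
  assumes s: "0 \<le> s" "s \<le> t" and \<xi>: "\<xi> \<in> ball_at s"
  shows "norm (x s t \<xi> - y s t \<xi>) \<le> D * C powr q * \<delta> powr q * J Z * (rate s t * norm \<xi>)"
proof -
  have "((\<lambda>r. blinfun_apply (U_op T P t r) (fx s \<xi> r)) has_integral
      (x s t \<xi> - blinfun_apply (U_op T P t s) \<xi>)) {s..t}"
    "((\<lambda>r. blinfun_apply (U_op T P t r) (gy s \<xi> r)) has_integral
      (y s t \<xi> - blinfun_apply (U_op T P t s) \<xi>)) {s..t}"
    using x[OF s(1)] y[OF s(1)] s \<xi> unfolding is_x_phi_def by blast+
  from has_integral_diff[OF this]
  have I: "((\<lambda>r. blinfun_apply (U_op T P t r) (fx s \<xi> r - gy s \<xi> r)) has_integral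
      (x s t \<xi> - y s t \<xi>)) {s..t}" by (simp add: blinfun.diff_right)
  have H: "0 \<le> D * J Z * (rate s t * norm \<xi>)"
    using rate_pos'[OF s] J_nonneg[OF Z] const by simp
  have "norm (blinfun_apply (U_op T P t r) (fx s \<xi> r - gy s \<xi> r))
      \<le> D * J Z * (rate s t * norm \<xi>) * (rate s r * norm \<xi>) powr q * \<nu> r powr \<epsilon>"
    if r: "r \<in> {s..t}" for r
  proof -
    have r0: "0 \<le> r" "s \<le> r" "r \<le> t" "0 \<le> t" using r s by auto
    have Y: "0 \<le> rate s r * norm \<xi>" using rate_pos'[OF s(1) r0(2)] by simp
    have "norm (blinfun_apply (U_op T P t r) (fx s \<xi> r - gy s \<xi> r))
        \<le> norm (U_op T P t r) * norm (fx s \<xi> r - gy s \<xi> r)" by (rule norm_blinfun)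
    also have "\<dots> \<le> (D * (\<mu> t / \<mu> r) powr a * \<nu> r powr \<epsilon>)
        * (J Z * (rate s r * norm \<xi>) powr (q + 1))"
      using const by (intro mult_mono norm_U_op_le integrand_bound \<xi> s r0) auto
    also have "\<dots> = D * J Z * ((\<mu> t / \<mu> r) powr a * (rate s r * norm \<xi>))
        * (rate s r * norm \<xi>) powr q * \<nu> r powr \<epsilon>"
      using Y by (cases "rate s r * norm \<xi> = 0") (simp_all add: powr_add mult_ac)
    also have "(\<mu> t / \<mu> r) powr a * (rate s r * norm \<xi>) = rate s t * norm \<xi>"
      using rate_pos[of s] rate_pos[of t] rate_pos[of r] s r0 by (simp add: powr_divide field_simps)
    finally show ?thesis .
  qed
  from rate_integral_bound[OF I _ s(1) \<delta> \<xi> H C_pos this]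
  have "norm (x s t \<xi> - y s t \<xi>)
      \<le> D * J Z * (rate s t * norm \<xi>) * (C powr q * \<delta> powr q * \<nu> s powr (- \<epsilon>))" by blast
  \<comment> \<open>The surplus factor \<open>\<nu> s powr (- \<epsilon>)\<close> is at most 1 and
    is dropped.\<close>
  also have "\<dots> \<le> D * J Z * (rate s t * norm \<xi>) * (C powr q * \<delta> powr q * 1)"
    using ge_one_powr_ge_zero[OF rate_ge1(2)[OF s(1)], of \<epsilon>] const
    by (intro mult_left_mono[OF _ H] mult_left_mono) (auto simp: powr_minus inverse_le_1_iff)
  finally show ?thesis by (simp add: mult_ac)
qed

text \<open>The factor \<open>(\<mu> r / \<mu> s) powr (- b)\<close> of \<open>V_inv\<close> times
  the decay of the trajectory is at most 1, which leaves
  \<open>C * \<nu> s powr \<epsilon> * norm \<xi>\<close> outside the integral. The negative power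
  of \<open>\<nu> s\<close> from \<open>rate_integral_bound\<close> cancels the positive
  one.\<close>

lemma phi_step:
  assumes s: "0 \<le> s" and \<xi>: "\<xi> \<in> ball_at s"
  shows "norm (\<phi> s \<xi> - \<psi> s \<xi>) \<le> C * (D * C powr q * \<delta> powr q * J Z) * norm \<xi>"
proof -
  \<comment> \<open>The integrals represent \<open>- \<phi> s \<xi>\<close> and
    \<open>- \<psi> s \<xi>\<close>, hence the reversed order of subtraction.\<close>
  from has_integral_diff[OF psi_eq[OF s \<xi>] phi_eq[OF s \<xi>]]
  have I: "((\<lambda>r. - blinfun_apply (V_inv T P r s) (fx s \<xi> r - gy s \<xi> r)) has_integral
      (\<phi> s \<xi> - \<psi> s \<xi>)) {s..}" by (simp add: blinfun.diff_right)
  have H: "0 \<le> D * J Z * (C * \<nu> s powr \<epsilon> * norm \<xi>)"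
    using C_pos J_nonneg[OF Z] const by simp
  have "norm (- blinfun_apply (V_inv T P r s) (fx s \<xi> r - gy s \<xi> r))
      \<le> D * J Z * (C * \<nu> s powr \<epsilon> * norm \<xi>) * (rate s r * norm \<xi>) powr q * \<nu> r powr \<epsilon>"
    if r: "r \<in> {s..}" for r
  proof -
    have r0: "0 \<le> r" "s \<le> r" using r s by auto
    have Y: "0 \<le> rate s r * norm \<xi>" using rate_pos'[OF s r0(2)] by simp
    have m: "1 \<le> \<mu> r / \<mu> s" using rate_mono[OF s r0(2)] rate_pos[OF s] by simp
    have "(\<mu> r / \<mu> s) powr (a - b) \<le> (\<mu> r / \<mu> s) powr 0"
      using m const by (intro powr_mono) auto
    then have m1: "(\<mu> r / \<mu> s) powr (- b) * (\<mu> r / \<mu> s) powr a \<le> 1"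
      using m rate_pos[OF s] rate_pos[OF r0(1)] by (simp flip: powr_add)
    have "norm (- blinfun_apply (V_inv T P r s) (fx s \<xi> r - gy s \<xi> r))
        \<le> norm (V_inv T P r s) * norm (fx s \<xi> r - gy s \<xi> r)"
      by (simp add: norm_blinfun)
    also have "\<dots> \<le> (D * (\<mu> r / \<mu> s) powr (- b) * \<nu> r powr \<epsilon>)
        * (J Z * (rate s r * norm \<xi>) powr (q + 1))"
      using const by (intro mult_mono norm_V_inv_le integrand_bound \<xi> s r0) auto
    also have "\<dots> = ((\<mu> r / \<mu> s) powr (- b) * (\<mu> r / \<mu> s) powr a)
        * (D * J Z * (C * \<nu> s powr \<epsilon> * norm \<xi>) * (rate s r * norm \<xi>) powr q * \<nu> r powr \<epsilon>)"
      using Y by (cases "rate s r * norm \<xi> = 0") (simp_all add: powr_add mult_ac)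
    also have "\<dots> \<le> 1
        * (D * J Z * (C * \<nu> s powr \<epsilon> * norm \<xi>) * (rate s r * norm \<xi>) powr q * \<nu> r powr \<epsilon>)"
      using m1 H by (intro mult_right_mono) auto
    finally show ?thesis by simp
  qed
  from rate_integral_bound[OF I _ s \<delta> \<xi> H C_pos this]
  have "norm (\<phi> s \<xi> - \<psi> s \<xi>)
      \<le> D * J Z * (C * \<nu> s powr \<epsilon> * norm \<xi>) * (C powr q * \<delta> powr q * \<nu> s powr (- \<epsilon>))" by blast
  also have "\<dots> = C * (D * C powr q * \<delta> powr q * J Z) * norm \<xi>"
    using rate_pos[OF s] by (simp add: powr_minus field_simps)
  finally show ?thesis .
qed

text \<open>The two improved factors are \<open>k\<close> and \<open>C * k\<close>; both are
  nonnegative, so each is at most \<open>(1 + C) * k\<close>. The hypothesis \<open>small\<close>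
  says that the coefficient of \<open>Z\<close> in this sum is at most 1/2.\<close>

lemma step_factor:
  fixes k
  defines "k \<equiv> D * C powr q * \<delta> powr q * J Z"
  shows "k \<le> Z / 2 + (1 + C) * D * C powr q * \<delta> powr q * 2 powr (q + 1) * M" (is "_ \<le> ?B")
    and "C * k \<le> Z / 2 + (1 + C) * D * C powr q * \<delta> powr q * 2 powr (q + 1) * M"
proof -
  have k: "0 \<le> k" using J_nonneg[OF Z] const by (simp add: k_def)
  have "(1 + C) * k = (4 * (1 + C) * D * C powr q * \<delta> powr q * c * 4 powr q) * Z
      + (1 + C) * D * C powr q * \<delta> powr q * 2 powr (q + 1) * M"
    unfolding k_def J_def by algebra
  also have "\<dots> \<le> (1 / 2) * Z + (1 + C) * D * C powr q * \<delta> powr q * 2 powr (q + 1) * M"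
    using mult_right_mono[OF small Z] by linarith
  finally have "k + C * k \<le> ?B" by (simp add: distrib_right)
  moreover have "0 \<le> C * k" using k C_pos by simp
  ultimately show "k \<le> ?B" "C * k \<le> ?B" using k by linarith+
qed

end

text \<open>Graphs and trajectories share one set of relative distances, since improving either
  bound needs a bound for both. \<open>contractive_bound\<close> then applies with the a priori
  bound 2.\<close>

lemma graph_bound:
  assumes "0 \<le> s" "\<xi> \<in> ball_at s" "\<xi> \<noteq> 0"
  shows "norm (\<phi> s \<xi> - \<psi> s \<xi>) / norm \<xi>
    \<le> 2 * ((1 + C) * D * C powr q * \<delta> powr q * 2 powr (q + 1) * M)" (is "_ \<le> 2 * ?k")
proof -
  define S where "S = {norm (\<phi> s \<xi> - \<psi> s \<xi>) / norm \<xi> |s \<xi>. 0 \<le> s \<and> \<xi> \<in> ball_at s \<and> \<xi> \<noteq> 0}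
    \<union> {norm (x s t \<xi> - y s t \<xi>) / (rate s t * norm \<xi>) |s t \<xi>.
        0 \<le> s \<and> s \<le> t \<and> \<xi> \<in> ball_at s \<and> \<xi> \<noteq> 0}"
  \<comment> \<open>Clearing the positive denominators turns bounds on \<open>S\<close> into the
    form required of \<open>Z\<close> above.\<close>
  have S_iff: "(\<forall>v\<in>S. v \<le> Z) \<longleftrightarrow>
      (\<forall>s \<xi>. 0 \<le> s \<and> \<xi> \<in> ball_at s \<and> \<xi> \<noteq> 0 \<longrightarrow> norm (\<phi> s \<xi> - \<psi> s \<xi>) \<le> Z * norm \<xi>) \<and>
      (\<forall>s t \<xi>. 0 \<le> s \<and> s \<le> t \<and> \<xi> \<in> ball_at s \<and> \<xi> \<noteq> 0 \<longrightarrow>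
        norm (x s t \<xi> - y s t \<xi>) \<le> Z * (rate s t * norm \<xi>))" for Z
  proof -
    have "norm u / (rate s t * norm \<xi>) \<le> Z \<longleftrightarrow> norm u \<le> Z * (rate s t * norm \<xi>)"
      if "0 \<le> s" "s \<le> t" "\<xi> \<noteq> 0" for s t u and \<xi> :: 'a
      using that by (intro pos_divide_le_eq mult_pos_pos[OF rate_pos']) auto
    moreover have "norm u / norm \<xi> \<le> Z \<longleftrightarrow> norm u \<le> Z * norm \<xi>" if "\<xi> \<noteq> 0" for u \<xi> :: 'a
      using that by (intro pos_divide_le_eq) simp
    ultimately show ?thesis unfolding S_def by blast
  qed
  have nonneg: "0 \<le> v" if "v \<in> S" for v
    using that C_pos by (fastforce simp: S_def)
  have phi2: "norm (\<phi> s \<xi> - \<psi> s \<xi>) \<le> 2 * norm \<xi>" if "0 \<le> s" "\<xi> \<in> ball_at s" for s \<xi>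
    using X_space_norm_le[OF phi that] X_space_norm_le[OF psi that]
      norm_triangle_ineq4[of "\<phi> s \<xi>" "\<psi> s \<xi>"] by linarith
  have x2: "norm (x s t \<xi> - y s t \<xi>) \<le> 2 * (rate s t * norm \<xi>)"
    if "0 \<le> s" "s \<le> t" "\<xi> \<in> ball_at s" for s t \<xi>
    using norm_x_le(1,2)[OF that] norm_triangle_ineq4[of "x s t \<xi>" "y s t \<xi>"] by linarith
  have two: "\<forall>v\<in>S. v \<le> 2"
    unfolding S_iff using phi2 x2 by blast
  have step: "\<forall>v\<in>S. v \<le> Z / 2 + ?k" if Z: "0 \<le> Z" and ZS: "\<forall>v\<in>S. v \<le> Z" for Z
  proof -
    \<comment> \<open>At \<open>\<xi> = 0\<close>, which \<open>S\<close> omits, the a priori bounds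
      already force both differences to vanish.\<close>
    have p: "norm (\<phi> s \<xi> - \<psi> s \<xi>) \<le> Z * norm \<xi>" if "0 \<le> s" "\<xi> \<in> ball_at s" for s \<xi>
      using ZS that phi2[OF that] unfolding S_iff by (cases "\<xi> = 0") auto
    have xy: "norm (x s t \<xi> - y s t \<xi>) \<le> Z * (rate s t * norm \<xi>)"
      if "0 \<le> s" "s \<le> t" "\<xi> \<in> ball_at s" for s t \<xi>
      using ZS that x2[OF that] unfolding S_iff by (cases "\<xi> = 0") auto
    show ?thesis
      unfolding S_iff
    proof (intro conjI allI impI)
      fix s \<xi> assume "0 \<le> s \<and> \<xi> \<in> ball_at s \<and> \<xi> \<noteq> 0"
      then have "norm (\<phi> s \<xi> - \<psi> s \<xi>) \<le> C * (D * C powr q * \<delta> powr q * J Z) * norm \<xi>"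
        by (intro phi_step[OF Z p xy]) auto
      also have "\<dots> \<le> (Z / 2 + ?k) * norm \<xi>"
        by (intro mult_right_mono step_factor(2)[OF Z p xy]) auto
      finally show "norm (\<phi> s \<xi> - \<psi> s \<xi>) \<le> (Z / 2 + ?k) * norm \<xi>" .
    next
      fix s t \<xi> assume st: "0 \<le> s \<and> s \<le> t \<and> \<xi> \<in> ball_at s \<and> \<xi> \<noteq> 0"
      then have Y: "0 \<le> rate s t * norm \<xi>"
        using rate_pos'[of s t] by (simp only: less_imp_le mult_nonneg_nonneg norm_ge_zero)
      have "norm (x s t \<xi> - y s t \<xi>) \<le> D * C powr q * \<delta> powr q * J Z * (rate s t * norm \<xi>)"
        using st by (intro x_step[OF Z p xy]) auto
      also have "\<dots> \<le> (Z / 2 + ?k) * (rate s t * norm \<xi>)"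
        using Y by (intro mult_right_mono step_factor(1)[OF Z p xy])
      finally show "norm (x s t \<xi> - y s t \<xi>) \<le> (Z / 2 + ?k) * (rate s t * norm \<xi>)" .
    qed
  qed
  have "norm (\<phi> s \<xi> - \<psi> s \<xi>) / norm \<xi> \<in> S" using assms unfolding S_def by blast
  then show ?thesis
    using contractive_bound[of S 2 ?k] nonneg two step by blast
qed

end

section \<open>Choice of the radius and of the Lipschitz constant\<close>

theorem theorem5p1:
  fixes A :: "real \<Rightarrow> 'a::banach \<Rightarrow>\<^sub>L 'a"
    and T :: "real \<Rightarrow> real \<Rightarrow> 'a \<Rightarrow>\<^sub>L 'a"
    and P :: "real \<Rightarrow> 'a \<Rightarrow>\<^sub>L 'a"
    and \<mu> \<nu> :: "real \<Rightarrow> real"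
    and c q D a b \<epsilon> C :: real
  assumes "continuous_on {0..} A"
    and "evolution_operator A T"
    and "0 < c" and "0 < q"
    and "growth_rate \<mu>" and "growth_rate \<nu>"
    and "1 \<le> D" and "a < 0" and "0 \<le> b" and "0 < \<epsilon>"
    and "nonuniform_dichotomy T P \<mu> \<nu> D a b \<epsilon>"
    and "((\<lambda>t. \<mu> t powr (a - b) * \<nu> t powr \<epsilon>) \<longlongrightarrow> 0) at_top"
    and "(\<lambda>r. \<mu> r powr (a * q) * \<nu> r powr \<epsilon>) integrable_on {0..}"
    and "antimono_on {0..} (beta_fun \<mu> \<nu> a \<epsilon> q)"
    and "antimono_on {0..} (\<lambda>t. \<mu> t powr a * inverse (beta_fun \<mu> \<nu> a \<epsilon> q t))"
    and "D < C"
  shows "\<exists>\<delta>\<^sub>0>0. \<forall>\<delta>. 0 < \<delta> \<and> \<delta> \<le> \<delta>\<^sub>0 \<longrightarrow>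
    (\<exists>K::real. 0 < K \<and>
      (\<forall>f \<in> pert_class c q. \<forall>g \<in> pert_class c q. \<forall>\<phi> \<psi>.
         uniquely_solvable A f \<longrightarrow> uniquely_solvable A g \<longrightarrow>
         stable_manifold_function A T P \<mu> \<nu> a \<epsilon> q C \<delta> f \<phi> \<longrightarrow>
         stable_manifold_function A T P \<mu> \<nu> a \<epsilon> q C \<delta> g \<psi> \<longrightarrow>
         X_dist P \<delta> (beta_fun \<mu> \<nu> a \<epsilon> q) \<phi> \<psi> \<le> ennreal K * pert_dist q f g))"
proof -
  let ?\<beta> = "beta_fun \<mu> \<nu> a \<epsilon> q"
  have C: "0 < C" using assms by linarith
  \<comment> \<open>\<open>m\<close> is the left-hand side of the smallness condition without
    \<open>\<delta> powr q\<close>, and \<open>\<delta>\<^sub>0\<close> solves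
    \<open>m * \<delta>\<^sub>0 powr q = 1 / 2\<close>.\<close>
  define m where "m = 4 * (1 + C) * D * C powr q * c * 4 powr q"
  have m: "0 < m" using assms C by (simp add: m_def)
  define \<delta>\<^sub>0 where "\<delta>\<^sub>0 = (1 / (2 * m)) powr (1 / q)"
  have small: "4 * (1 + C) * D * C powr q * \<delta> powr q * c * 4 powr q \<le> 1 / 2"
    if "0 < \<delta>" "\<delta> \<le> \<delta>\<^sub>0" for \<delta>
  proof -
    have "\<delta> powr q \<le> \<delta>\<^sub>0 powr q" using that assms by (intro powr_mono2) auto
    also have "\<dots> = 1 / (2 * m)" using assms m by (simp add: \<delta>\<^sub>0_def powr_powr)
    finally have "m * \<delta> powr q \<le> 1 / 2" using m by (simp add: field_simps)
    then show ?thesis by (simp add: m_def mult_ac)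
  qed
  show ?thesis
  proof (rule exI[of _ \<delta>\<^sub>0], intro conjI allI impI)
    show "0 < \<delta>\<^sub>0" using m by (simp add: \<delta>\<^sub>0_def)
    fix \<delta> assume \<delta>: "0 < \<delta> \<and> \<delta> \<le> \<delta>\<^sub>0"
    \<comment> \<open>This is the bound of \<open>graph_bound\<close> with \<open>M\<close> split
      off, so it depends on \<open>\<delta>\<close> but not on the perturbations.\<close>
    define K where "K = 2 * ((1 + C) * D * C powr q * \<delta> powr q * 2 powr (q + 1))"
    have K: "0 < K" using C \<delta> assms by (simp add: K_def)
    have "X_dist P \<delta> ?\<beta> \<phi> \<psi> \<le> ennreal K * pert_dist q f g"
      if f: "f \<in> pert_class c q" and g: "g \<in> pert_class c q"
        and smf: "stable_manifold_function A T P \<mu> \<nu> a \<epsilon> q C \<delta> f \<phi>"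
        and smg: "stable_manifold_function A T P \<mu> \<nu> a \<epsilon> q C \<delta> g \<psi>" for f g \<phi> \<psi>
    proof (cases "pert_dist q f g")
      case (real M)
      have eqs: "phi_equation T P \<mu> \<nu> a \<epsilon> C \<delta> ?\<beta> f \<phi>" "phi_equation T P \<mu> \<nu> a \<epsilon> C \<delta> ?\<beta> g \<psi>"
        using smf smg by (simp_all add: stable_manifold_function_def)
      from phi_equation_choice[OF eqs(1)] obtain x
        where x: "\<And>s. 0 \<le> s \<Longrightarrow> is_x_phi T P \<mu> \<nu> a \<epsilon> C \<delta> ?\<beta> f \<phi> s (x s)"
          "\<And>s \<xi>. 0 \<le> s \<Longrightarrow> \<xi> \<in> B_ball P \<delta> ?\<beta> s \<Longrightarrow>
            ((\<lambda>r. blinfun_apply (V_inv T P r s) (f r (x s r \<xi> + extend P \<delta> ?\<beta> \<phi> r (x s r \<xi>))))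
              has_integral (- \<phi> s \<xi>)) {s..}" by blast
      from phi_equation_choice[OF eqs(2)] obtain y
        where y: "\<And>s. 0 \<le> s \<Longrightarrow> is_x_phi T P \<mu> \<nu> a \<epsilon> C \<delta> ?\<beta> g \<psi> s (y s)"
          "\<And>s \<xi>. 0 \<le> s \<Longrightarrow> \<xi> \<in> B_ball P \<delta> ?\<beta> s \<Longrightarrow>
            ((\<lambda>r. blinfun_apply (V_inv T P r s) (g r (y s r \<xi> + extend P \<delta> ?\<beta> \<psi> r (y s r \<xi>))))
              has_integral (- \<psi> s \<xi>)) {s..}" by blast
      interpret two_perturbations T P \<mu> \<nu> q D a b \<epsilon> c C \<delta> M f g \<phi> \<psi> x y
      proof (intro two_perturbations.intro dichotomy.intro two_perturbations_axioms.intro)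
        show "\<phi> \<in> X_space P \<delta> ?\<beta>" "\<psi> \<in> X_space P \<delta> ?\<beta>"
          using smf smg by (simp_all add: stable_manifold_function_def)
        show "norm (f t u - g t u) \<le> M * norm u powr (q + 1)" if "0 \<le> t" for t u
          by (rule pert_dist_bound[OF f g real(2,1) that])
      qed (use \<delta> assms small[of \<delta>] f real(1) x y in simp_all)
      have "norm (\<phi> s \<xi> - \<psi> s \<xi>) / norm \<xi> \<le> K * M"
        if "(s, \<xi>) \<in> G_set P \<delta> ?\<beta>" "\<xi> \<noteq> 0" for s \<xi>
        using graph_bound[of s \<xi>] that by (simp add: G_set_def K_def mult_ac)
      then have "X_dist P \<delta> ?\<beta> \<phi> \<psi> \<le> ennreal (K * M)"
        unfolding X_dist_def by (intro SUP_least) (auto intro: ennreal_leI)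
      then show ?thesis using K real by (simp add: ennreal_mult)
    next
      \<comment> \<open>For an infinite distance the right-hand side is infinite, because
        \<open>K\<close> is positive.\<close>
      case top
      then show ?thesis using K by (simp add: ennreal_mult_top)
    qed
    then show "\<exists>K::real. 0 < K \<and>
      (\<forall>f \<in> pert_class c q. \<forall>g \<in> pert_class c q. \<forall>\<phi> \<psi>.
         uniquely_solvable A f \<longrightarrow> uniquely_solvable A g \<longrightarrow>
         stable_manifold_function A T P \<mu> \<nu> a \<epsilon> q C \<delta> f \<phi> \<longrightarrow>
         stable_manifold_function A T P \<mu> \<nu> a \<epsilon> q C \<delta> g \<psi> \<longrightarrow>
         X_dist P \<delta> ?\<beta> \<phi> \<psi> \<le> ennreal K * pert_dist q f g)"
      using K by blast
  qed
qed

end
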